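(* For each positive integer $k$, there exists a completely positive semidefinite matrix $M$ of size $4k^2+2k+2$ (that is, $M$ is a $(4k^2+2k+2)\times(4k^2+2k+2)$ matrix) with $\operatorname{cpsd-rank}_{\mathbb{C}}(M)=2^k$.
   Context: For $X,Y\in\mathbb{C}^{d\times d}$ write $\langle X,Y\rangle=\mathrm{Tr}(X^*Y)$ for the trace inner product, where $X^*$ is the conjugate transpose. A real symmetric $n\times n$ matrix $M$ is called completely positive semidefinite if, for some $d\ge 1$, there exist (real symmetric or complex Hermitian) positive semidefinite $d\times d$ matrices $X_1,\ldots,X_n$ such that $M_{i,j}=\langle X_i,X_j\rangle$ for all $i,j\in\{1,\ldots,n\}$. The complex completely positive semidefinite rank $\operatorname{cpsd-rank}_{\mathbb{C}}(M)$ of such a matrix is the smallest $d$ for which such $X_1,\ldots,X_n$ exist that are Hermitian positive semidefinite $d\times d$ matrices. *)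

theory Defs
  imports "Jordan_Normal_Form.Schur_Decomposition"
begin

definition mat_trace :: "'a :: comm_monoid_add mat \<Rightarrow> 'a" where
  "mat_trace A = (\<Sum>i<dim_row A. A $$ (i, i))"

definition trace_inner :: "complex mat \<Rightarrow> complex mat \<Rightarrow> complex" where
  "trace_inner X Y = mat_trace (mat_adjoint X * Y)"

(* The order on complex is the one of HOL-Library.Complex_Order: 0 <= z means that z is
   real and nonnegative. Since v \<bullet>c w conjugates its second argument, the quadratic form
   below is v* A v. *)
definition hermitian_psd :: "nat \<Rightarrow> complex mat \<Rightarrow> bool" where
  "hermitian_psd d A \<longleftrightarrow>
     A \<in> carrier_mat d d \<and> mat_adjoint A = A \<and>
     (\<forall>v \<in> carrier_vec d. 0 \<le> (A *\<^sub>v v) \<bullet>c v)"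

definition cpsd_factorization :: "nat \<Rightarrow> real mat \<Rightarrow> nat \<Rightarrow> (nat \<Rightarrow> complex mat) \<Rightarrow> bool" where
  "cpsd_factorization n M d X \<longleftrightarrow>
     (\<forall>i<n. hermitian_psd d (X i)) \<and>
     (\<forall>i<n. \<forall>j<n. complex_of_real (M $$ (i, j)) = trace_inner (X i) (X j))"

(* Real symmetric positive semidefinite factors need no separate clause: regarded as complex
   matrices they are Hermitian positive semidefinite. *)
definition completely_psd :: "nat \<Rightarrow> real mat \<Rightarrow> bool" where
  "completely_psd n M \<longleftrightarrow>
     M \<in> carrier_mat n n \<and> transpose_mat M = M \<and>
     (\<exists>d\<ge>1. \<exists>X. cpsd_factorization n M d X)"

(* Only meaningful for completely positive semidefinite M; otherwise no such d exists and
   the value is unspecified. *)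
definition cpsd_rank_complex :: "real mat \<Rightarrow> nat" where
  "cpsd_rank_complex M = (LEAST d. d \<ge> 1 \<and> (\<exists>X. cpsd_factorization (dim_row M) M d X))"

end

theory Submission
  imports Defs
begin

text \<open>
  The matrix is the Gram matrix of projections built from a Clifford algebra, chosen so that the
  Gram entries alone force every factorization to carry a representation of that algebra.

  Let \<open>\<gamma>\<^sub>0, \<dots>, \<gamma>\<^bsub>2k-1\<^esub>\<close> be pairwise anticommuting Hermitian matrices of size \<open>2\<^sup>k\<close> with square \<open>1\<close>.
  For \<open>i \<noteq> j\<close>, a real unit vector \<open>(a, b)\<close> gives a reflection \<open>a \<gamma>\<^sub>i + b \<gamma>\<^sub>j\<close>, again Hermitian with square \<open>1\<close>,
  and hence two complementary projections \<open>(1 \<plusminus> (a \<gamma>\<^sub>i + b \<gamma>\<^sub>j)) / 2\<close>. The \<open>2k\<close> reflections \<open>\<gamma>\<^sub>i\<close> and the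
  \<open>k(2k-1)\<close> reflections with \<open>(a, b) = (3/5, 4/5)\<close> and \<open>i < j\<close> provide \<open>4k\<^sup>2 + 2k\<close> projections; two zero
  matrices bring the family to the required size.

  Suppose that positive semidefinite matrices \<open>X\<close> of size \<open>d\<close> have the same Gram matrix. Two
  properties survive. A Gram matrix determines all linear relations between its vectors, because
  the norm of a linear combination is a quadratic form in the entries
  (\<open>gram_relation_transfer\<close>). And positive semidefinite matrices with trace inner product \<open>0\<close> have
  product \<open>0\<close> (\<open>psd_orthogonal_mult_eq_0\<close>). The relations say that the sum \<open>K\<close> of the two
  matrices of a complementary pair is the same for all pairs, and that the differences \<open>D\<^bsub>ij\<^esub>\<close> satisfy
  \<open>D\<^bsub>ij\<^esub> = 3/5 D\<^bsub>ii\<^esub> + 4/5 D\<^bsub>jj\<^esub>\<close>. The vanishing products give \<open>D\<^bsub>ij\<^esub>\<^sup>2 = K\<^sup>2\<close>, and squaring the linear relation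
  leaves \<open>D\<^bsub>ii\<^esub> D\<^bsub>jj\<^esub> + D\<^bsub>jj\<^esub> D\<^bsub>ii\<^esub> = 0\<close>.

  So the \<open>D\<^bsub>ii\<^esub>\<close> anticommute, with a common square \<open>K\<^sup>2 \<noteq> 0\<close> that is central among them. Up to the
  factor \<open>K\<close>, the \<open>2\<^bsup>2k\<^esup>\<close> ordered products over subsets of the \<open>D\<^bsub>ii\<^esub>\<close> are nonzero and pairwise orthogonal
  in the \<open>d\<^sup>2\<close>-dimensional space of matrices (\<open>dimension_bound\<close>), whence \<open>4\<^sup>k \<le> d\<^sup>2\<close>.
\<close>

section \<open>The trace inner product\<close>

lemma cmod_square_eq_cnj_mult: "complex_of_real ((cmod z)\<^sup>2) = cnj z * z"
  using complex_norm_square[of z] by (simp add: mult.commute)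

lemma mat_adjoint_carrier [simp]:
  "A \<in> carrier_mat n m \<Longrightarrow> mat_adjoint A \<in> carrier_mat m n"
  unfolding mat_adjoint_def by auto

lemma mat_adjoint_dim [simp]:
  "dim_row (mat_adjoint A) = dim_col A" "dim_col (mat_adjoint A) = dim_row A"
  unfolding mat_adjoint_def by auto

lemma mat_adjoint_index [simp]:
  fixes A :: "complex mat"
  assumes "i < dim_col A" "j < dim_row A"
  shows "mat_adjoint A $$ (i, j) = cnj (A $$ (j, i))"
  using assms unfolding mat_adjoint_def
  by (simp add: mat_of_rows_index conjugate_complex_def)

lemma mat_adjoint_mult:
  fixes A B :: "complex mat"
  assumes "A \<in> carrier_mat n m" "B \<in> carrier_mat m l"
  shows "mat_adjoint (A * B) = mat_adjoint B * mat_adjoint A"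
  using assms by (intro eq_matI) (auto simp: scalar_prod_def mult.commute)

lemma mat_trace_mult:
  fixes A B :: "complex mat"
  assumes "A \<in> carrier_mat d d" "B \<in> carrier_mat d d"
  shows "mat_trace (A * B) = (\<Sum>a<d. \<Sum>b<d. A $$ (a, b) * B $$ (b, a))"
  using assms by (simp add: mat_trace_def scalar_prod_def atLeast0LessThan)

lemma mat_trace_mult_commute:
  fixes A B :: "complex mat"
  assumes "A \<in> carrier_mat d d" "B \<in> carrier_mat d d"
  shows "mat_trace (A * B) = mat_trace (B * A)"
  unfolding mat_trace_mult[OF assms] mat_trace_mult[OF assms(2,1)]
  by (subst sum.swap) (simp add: mult.commute)

lemma trace_inner_entries:
  assumes "X \<in> carrier_mat d d" "Y \<in> carrier_mat d d"
  shows "trace_inner X Y = (\<Sum>a<d. \<Sum>b<d. cnj (X $$ (a, b)) * Y $$ (a, b))"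
proof -
  have "trace_inner X Y = (\<Sum>a<d. \<Sum>b<d. cnj (X $$ (b, a)) * Y $$ (b, a))"
    unfolding trace_inner_def
    by (subst mat_trace_mult[of _ d]) (use assms in auto)
  then show ?thesis by (subst (asm) sum.swap)
qed

lemma trace_inner_hermitian:
  assumes "mat_adjoint X = X"
  shows "trace_inner X Y = mat_trace (X * Y)"
  using assms by (simp add: trace_inner_def)

lemma trace_inner_hermitian_real:
  assumes "X \<in> carrier_mat d d" "Y \<in> carrier_mat d d" "mat_adjoint X = X" "mat_adjoint Y = Y"
  shows "complex_of_real (Re (trace_inner X Y)) = trace_inner X Y"
    and "trace_inner X Y = trace_inner Y X"
proof -
  show sym: "trace_inner X Y = trace_inner Y X"
    using assms by (simp add: trace_inner_hermitian mat_trace_mult_commute)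
  have "cnj (trace_inner X Y) = trace_inner Y X"
    using assms by (simp add: trace_inner_entries mult.commute)
  then have "cnj (trace_inner X Y) = trace_inner X Y" using sym by simp
  then show "complex_of_real (Re (trace_inner X Y)) = trace_inner X Y"
    by (simp add: complex_eq_iff)
qed

lemma trace_inner_self:
  assumes "X \<in> carrier_mat d d"
  shows "trace_inner X X = complex_of_real (\<Sum>a<d. \<Sum>b<d. (cmod (X $$ (a, b)))\<^sup>2)"
  unfolding trace_inner_entries[OF assms assms] of_real_sum cmod_square_eq_cnj_mult ..

lemma trace_inner_self_eq_0D:
  assumes "X \<in> carrier_mat d d" "trace_inner X X = 0"
  shows "X = 0\<^sub>m d d"
proof -
  have "(\<Sum>a<d. \<Sum>b<d. (cmod (X $$ (a, b)))\<^sup>2) = 0"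
    using assms trace_inner_self[OF assms(1)] by (metis of_real_eq_0_iff)
  then have "\<forall>a<d. \<forall>b<d. X $$ (a, b) = 0"
    by (simp add: sum_nonneg_eq_0_iff sum_nonneg)
  then show ?thesis using assms(1) by (intro eq_matI) auto
qed

text \<open>
  A self-adjoint factor on the right or on the left enters the inner product only through its
  square. This is how an equality of squares turns into an equality of inner products.
\<close>

lemma trace_inner_mult_right:
  assumes "Z \<in> carrier_mat d d" "W \<in> carrier_mat d d" "L \<in> carrier_mat d d"
    and "mat_adjoint L = L"
  shows "trace_inner (Z * L) (W * L) = mat_trace (mat_adjoint Z * W * (L * L))"
proof -
  have c: "mat_adjoint Z \<in> carrier_mat d d" using assms by simp
  have "trace_inner (Z * L) (W * L) = mat_trace (L * (mat_adjoint Z * W * L))"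
    unfolding trace_inner_def using assms c
    by (simp add: mat_adjoint_mult[of Z d d L d] assoc_mult_mat[of _ d d _ d _ d])
  also have "\<dots> = mat_trace (mat_adjoint Z * W * L * L)"
    by (rule mat_trace_mult_commute[OF assms(3)])
      (rule mult_carrier_mat[OF mult_carrier_mat[OF c assms(2)] assms(3)])
  also have "\<dots> = mat_trace (mat_adjoint Z * W * (L * L))"
    using assms c by (simp add: assoc_mult_mat[of _ d d _ d _ d])
  finally show ?thesis .
qed

lemma trace_inner_mult_left:
  assumes "Z \<in> carrier_mat d d" "W \<in> carrier_mat d d" "L \<in> carrier_mat d d"
    and "mat_adjoint L = L"
  shows "trace_inner (L * Z) (L * W) = mat_trace (mat_adjoint Z * (L * L) * W)"
proof -
  have c: "mat_adjoint Z \<in> carrier_mat d d" using assms by simp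
  show ?thesis
    unfolding trace_inner_def using assms c
    by (simp add: mat_adjoint_mult[of L d d Z d] assoc_mult_mat[of _ d d _ d _ d])
qed

lemma trace_inner_smult:
  assumes "X \<in> carrier_mat d d" "Y \<in> carrier_mat d d"
  shows "trace_inner (a \<cdot>\<^sub>m X) (b \<cdot>\<^sub>m Y) = cnj a * b * trace_inner X Y"
  using assms by (simp add: trace_inner_entries[of _ d] sum_distrib_left mult_ac)

section \<open>Linear relations are determined by the Gram matrix\<close>

lemma gram_relation_norm:
  fixes X :: "nat \<Rightarrow> complex mat" and c :: "nat \<Rightarrow> real"
  assumes "\<And>q. q < m \<Longrightarrow> X q \<in> carrier_mat d d"
  shows "complex_of_real (\<Sum>a<d. \<Sum>b<d. (cmod (\<Sum>q<m. of_real (c q) * X q $$ (a, b)))\<^sup>2)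
       = (\<Sum>p<m. \<Sum>q<m. of_real (c p * c q) * trace_inner (X p) (X q))"
proof -
  have "complex_of_real (\<Sum>a<d. \<Sum>b<d. (cmod (\<Sum>q<m. of_real (c q) * X q $$ (a, b)))\<^sup>2)
      = (\<Sum>a<d. \<Sum>b<d. (\<Sum>p<m. \<Sum>q<m.
           of_real (c p * c q) * (cnj (X p $$ (a, b)) * X q $$ (a, b))))"
    unfolding of_real_sum
    by (intro sum.cong refl) (simp only: cmod_square_eq_cnj_mult cnj_sum sum_product, simp add: mult_ac)
  also have "\<dots> = (\<Sum>p<m. \<Sum>q<m. \<Sum>a<d. \<Sum>b<d.
           of_real (c p * c q) * (cnj (X p $$ (a, b)) * X q $$ (a, b)))"
    by (simp only: sum.swap[of _ "{..<m}" "{..<d}"])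
  also have "\<dots> = (\<Sum>p<m. \<Sum>q<m. of_real (c p * c q) * trace_inner (X p) (X q))"
    by (intro sum.cong refl) (simp add: trace_inner_entries[of _ d] assms sum_distrib_left)
  finally show ?thesis .
qed

text \<open>
  If \<open>\<Sum> c\<^sub>q X\<^sub>q = 0\<close> then the norm of \<open>\<Sum> c\<^sub>q Y\<^sub>q\<close>, computed from the same Gram entries, vanishes too. The
  relations are stated entrywise, so that the two families may consist of matrices of different size.
\<close>

lemma gram_relation_transfer:
  fixes X Y :: "nat \<Rightarrow> complex mat" and c :: "nat \<Rightarrow> real"
  assumes X: "\<And>q. q < m \<Longrightarrow> X q \<in> carrier_mat d d"
    and Y: "\<And>q. q < m \<Longrightarrow> Y q \<in> carrier_mat e e"
    and gram: "\<And>p q. p < m \<Longrightarrow> q < m \<Longrightarrow> trace_inner (X p) (X q) = trace_inner (Y p) (Y q)"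
    and rel: "\<And>a b. a < d \<Longrightarrow> b < d \<Longrightarrow> (\<Sum>q<m. of_real (c q) * X q $$ (a, b)) = 0"
    and "a < e" "b < e"
  shows "(\<Sum>q<m. of_real (c q) * Y q $$ (a, b)) = 0"
proof -
  have "complex_of_real (\<Sum>a<e. \<Sum>b<e. (cmod (\<Sum>q<m. of_real (c q) * Y q $$ (a, b)))\<^sup>2)
      = (\<Sum>p<m. \<Sum>q<m. of_real (c p * c q) * trace_inner (X p) (X q))"
    by (subst gram_relation_norm[of m Y e c, OF Y]) (auto simp: gram)
  also have "\<dots> = complex_of_real (\<Sum>a<d. \<Sum>b<d. (cmod (\<Sum>q<m. of_real (c q) * X q $$ (a, b)))\<^sup>2)"
    by (subst gram_relation_norm[of m X d c, OF X]) auto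
  also have "\<dots> = 0" by (simp add: rel)
  finally have "(\<Sum>a<e. \<Sum>b<e. (cmod (\<Sum>q<m. of_real (c q) * Y q $$ (a, b)))\<^sup>2) = 0"
    by (simp only: of_real_eq_0_iff)
  then have "\<forall>a<e. \<forall>b<e. (cmod (\<Sum>q<m. of_real (c q) * Y q $$ (a, b)))\<^sup>2 = 0"
    by (subst (asm) sum_nonneg_eq_0_iff, simp, simp add: sum_nonneg,
        subst (asm) sum_nonneg_eq_0_iff) auto
  then show ?thesis using assms(5,6) by simp
qed

text \<open>
  The relations used below compare a pair of projections with a fixed pair, which may be the same
  one. A list allows such an index to recur, where a coefficient function on \<open>T\<close> would need a case
  distinction.
\<close>

lemma gram_relation_transfer_list:
  fixes X Y :: "'i \<Rightarrow> complex mat" and L :: "(real \<times> 'i) list"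
  assumes X: "\<And>t. t \<in> T \<Longrightarrow> X t \<in> carrier_mat d d"
    and Y: "\<And>t. t \<in> T \<Longrightarrow> Y t \<in> carrier_mat e e"
    and gram: "\<And>s t. s \<in> T \<Longrightarrow> t \<in> T \<Longrightarrow> trace_inner (X s) (X t) = trace_inner (Y s) (Y t)"
    and L: "snd ` set L \<subseteq> T"
    and rel: "\<And>a b. a < d \<Longrightarrow> b < d \<Longrightarrow> (\<Sum>(c, t)\<leftarrow>L. of_real c * X t $$ (a, b)) = 0"
    and ab: "a < e" "b < e"
  shows "(\<Sum>(c, t)\<leftarrow>L. of_real c * Y t $$ (a, b)) = 0"
proof -
  have nth: "(\<Sum>(c, t)\<leftarrow>L. of_real c * Z t $$ (a, b))
      = (\<Sum>q<length L. of_real (fst (L ! q)) * Z (snd (L ! q)) $$ (a, b))" for Z :: "'i \<Rightarrow> complex mat" and a b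
    by (simp add: sum_list_sum_nth atLeast0LessThan case_prod_unfold)
  have T: "snd (L ! q) \<in> T" if "q < length L" for q
    using L nth_mem[OF that] by blast
  show ?thesis
    unfolding nth
    by (rule gram_relation_transfer[where X = "\<lambda>q. X (snd (L ! q))" and d = d])
      (use X Y gram T rel ab in \<open>simp_all add: nth\<close>)
qed

section \<open>Orthogonal families of vectors\<close>

text \<open>
  The coordinate form of Bessel's inequality for the unit vectors \<open>u\<^sub>i = w\<^sub>i / |w\<^sub>i|\<close>: for each coordinate
  \<open>b\<close> one has \<open>\<Sum>\<^sub>i |u\<^sub>i(b)|\<^sup>2 \<le> 1\<close>, and summing over \<open>b\<close> bounds the number of vectors by the number of
  coordinates.
\<close>

lemma card_orthogonal_family_le:
  fixes w :: "'i \<Rightarrow> 'b \<Rightarrow> complex"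
  assumes "finite F" "finite B"
    and orth: "\<And>i j. i \<in> F \<Longrightarrow> j \<in> F \<Longrightarrow> i \<noteq> j \<Longrightarrow> (\<Sum>b\<in>B. cnj (w i b) * w j b) = 0"
    and nz: "\<And>i. i \<in> F \<Longrightarrow> \<exists>b\<in>B. w i b \<noteq> 0"
  shows "card F \<le> card B"
proof -
  define N where "N i = (\<Sum>b\<in>B. (cmod (w i b))\<^sup>2)" for i
  have N: "N i > 0" if i: "i \<in> F" for i
  proof -
    obtain b where "b \<in> B" "w i b \<noteq> 0" using nz[OF i] by blast
    then show "N i > 0"
      unfolding N_def using \<open>finite B\<close> by (intro sum_pos2[of _ b]) auto
  qed
  have inner: "(\<Sum>b\<in>B. cnj (w i b) * w j b) = (if i = j then of_real (N i) else 0)"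
    if "i \<in> F" "j \<in> F" for i j
    using orth[OF that] unfolding N_def of_real_sum cmod_square_eq_cnj_mult by auto
  define s where "s b = (\<Sum>i\<in>F. (cmod (w i b))\<^sup>2 / N i)" for b
  have s_le: "s b \<le> 1" if "b \<in> B" for b
  proof -
    \<comment> \<open>\<open>x\<close> is the orthogonal projection of the \<open>b\<close>-th standard basis vector onto the span of \<open>w\<close>, so
      that its squared norm equals its \<open>b\<close>-th coordinate \<open>s b\<close>.\<close>
    define x where "x c = (\<Sum>i\<in>F. cnj (w i b) / of_real (N i) * w i c)" for c
    have xb: "x b = of_real (s b)"
      unfolding x_def s_def of_real_sum of_real_divide cmod_square_eq_cnj_mult by simp
    have "complex_of_real (\<Sum>c\<in>B. (cmod (x c))\<^sup>2) = (\<Sum>c\<in>B. cnj (x c) * x c)"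
      unfolding of_real_sum cmod_square_eq_cnj_mult ..
    also have "\<dots> = (\<Sum>c\<in>B. \<Sum>i\<in>F. \<Sum>j\<in>F. w i b / of_real (N i) * (cnj (w j b) / of_real (N j))
         * (cnj (w i c) * w j c))"
      unfolding x_def by (simp only: cnj_sum sum_product, simp add: mult_ac)
    also have "\<dots> = (\<Sum>i\<in>F. \<Sum>j\<in>F. w i b / of_real (N i) * (cnj (w j b) / of_real (N j))
         * (\<Sum>c\<in>B. cnj (w i c) * w j c))"
      by (subst sum.swap, rule sum.cong[OF refl], subst sum.swap) (simp add: sum_distrib_left)
    also have "\<dots> = (\<Sum>i\<in>F. \<Sum>j\<in>F. if i = j then
          w i b / of_real (N i) * (cnj (w j b) / of_real (N j)) * of_real (N i) else 0)"
      by (intro sum.cong refl) (simp add: inner)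
    also have "\<dots> = (\<Sum>i\<in>F. w i b * cnj (w i b) / of_real (N i))"
      using \<open>finite F\<close> N by (auto simp: sum.delta' intro!: sum.cong)
    also have "\<dots> = of_real (s b)"
      unfolding s_def of_real_sum of_real_divide cmod_square_eq_cnj_mult by (simp add: mult.commute)
    finally have "(\<Sum>c\<in>B. (cmod (x c))\<^sup>2) = s b" by (simp only: of_real_eq_iff)
    moreover have "(cmod (x b))\<^sup>2 \<le> (\<Sum>c\<in>B. (cmod (x c))\<^sup>2)"
      using that \<open>finite B\<close> by (intro member_le_sum) auto
    ultimately have "(s b)\<^sup>2 \<le> s b" by (simp add: xb)
    then show ?thesis by (cases "s b \<le> 0") (auto simp: power2_eq_square)
  qed
  have "real (card F) = (\<Sum>i\<in>F. (\<Sum>b\<in>B. (cmod (w i b))\<^sup>2) / N i)"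
    using N by (simp add: N_def[symmetric] less_imp_neq[THEN not_sym])
  also have "\<dots> = (\<Sum>b\<in>B. s b)"
    unfolding s_def by (subst sum.swap) (simp add: sum_divide_distrib)
  also have "\<dots> \<le> (\<Sum>b\<in>B. 1)" by (intro sum_mono s_le)
  finally show ?thesis by simp
qed


section \<open>Positive semidefinite matrices with orthogonal product\<close>

text \<open>
  Positive semidefiniteness in coordinates. Symmetry makes the quadratic form real, and so the
  second clause can speak of its real part, in the linear order of the reals.
\<close>

definition psd_kernel :: "nat \<Rightarrow> (nat \<Rightarrow> nat \<Rightarrow> complex) \<Rightarrow> bool" where
  "psd_kernel d Y \<longleftrightarrow> (\<forall>a<d. \<forall>b<d. Y b a = cnj (Y a b)) \<and>
     (\<forall>v. 0 \<le> Re (\<Sum>a<d. \<Sum>b<d. cnj (v a) * Y a b * v b))"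

lemma psd_kernel_nonneg:
  "psd_kernel d Y \<Longrightarrow> 0 \<le> Re (\<Sum>a<d. \<Sum>b<d. cnj (v a) * Y a b * v b)"
  unfolding psd_kernel_def by (elim conjE) (erule spec)

lemma sum_mult_delta:
  fixes f :: "nat \<Rightarrow> complex"
  assumes "i < d"
  shows "(\<Sum>b<d. f b * (if b = i then t else 0)) = f i * t"
proof -
  have "(\<Sum>b<d. f b * (if b = i then t else 0)) = (\<Sum>b<d. if b = i then f i * t else 0)"
    by (intro sum.cong) auto
  then show ?thesis using assms by simp
qed

lemma psd_kernel_hermitian:
  "psd_kernel d Y \<Longrightarrow> a < d \<Longrightarrow> b < d \<Longrightarrow> cnj (Y a b) = Y b a"
  unfolding psd_kernel_def by metis

text \<open>
  Moving \<open>v\<close> along one coordinate axis changes the quadratic form by a quadratic polynomial in the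
  step \<open>t\<close>. Choosing \<open>t\<close> well yields both lemmas on the kernel and on Schur complements below.
\<close>

lemma quadratic_form_shift:
  fixes Y :: "nat \<Rightarrow> nat \<Rightarrow> complex"
  assumes psd: "psd_kernel d Y" and i: "i < d"
  defines "g \<equiv> \<lambda>v. \<Sum>b<d. Y i b * v b"
  shows "(\<Sum>a<d. \<Sum>b<d. cnj (v a + (if a = i then t else 0)) * Y a b * (v b + (if b = i then t else 0)))
       = (\<Sum>a<d. \<Sum>b<d. cnj (v a) * Y a b * v b) + t * cnj (g v) + cnj t * g v + cnj t * t * Y i i"
proof -
  have expand: "(\<Sum>a<d. \<Sum>b<d. cnj (v a + e a) * Y a b * (v b + e b))
     = (\<Sum>a<d. \<Sum>b<d. cnj (v a) * Y a b * v b) + (\<Sum>a<d. \<Sum>b<d. cnj (v a) * Y a b * e b)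
     + (\<Sum>a<d. \<Sum>b<d. cnj (e a) * Y a b * v b) + (\<Sum>a<d. \<Sum>b<d. cnj (e a) * Y a b * e b)" for e
    by (simp only: complex_cnj_add distrib_left distrib_right sum.distrib add_ac)
  have 1: "(\<Sum>a<d. \<Sum>b<d. cnj (v a) * Y a b * (if b = i then t else 0)) = t * cnj (g v)"
  proof -
    have "(\<Sum>a<d. \<Sum>b<d. cnj (v a) * Y a b * (if b = i then t else 0))
        = (\<Sum>a<d. cnj (v a) * Y a i * t)"
      by (simp only: sum_mult_delta[OF i])
    also have "\<dots> = t * cnj (g v)"
      unfolding g_def cnj_sum sum_distrib_left
      by (intro sum.cong refl) (simp add: psd_kernel_hermitian[OF psd] i mult_ac)
    finally show ?thesis .
  qed
  have 2: "(\<Sum>a<d. \<Sum>b<d. cnj (if a = i then t else 0) * Y a b * v b) = cnj t * g v"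
  proof -
    have "(\<Sum>a<d. \<Sum>b<d. cnj (if a = i then t else 0) * Y a b * v b)
        = (\<Sum>a<d. if a = i then cnj t * g v else 0)"
      by (intro sum.cong refl) (simp add: g_def sum_distrib_left mult_ac)
    then show ?thesis using i by simp
  qed
  have 3: "(\<Sum>a<d. \<Sum>b<d. cnj (if a = i then t else 0) * Y a b * (if b = i then t else 0))
      = cnj t * t * Y i i"
  proof -
    have "(\<Sum>a<d. \<Sum>b<d. cnj (if a = i then t else 0) * Y a b * (if b = i then t else 0))
        = (\<Sum>a<d. if a = i then cnj t * t * Y i i else 0)"
      unfolding sum_mult_delta[OF i] by (intro sum.cong refl) auto
    then show ?thesis using i by simp
  qed
  show ?thesis unfolding expand[of "\<lambda>a. if a = i then t else 0"] 1 2 3 ..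
qed

lemma psd_kernel_diag_nonneg:
  assumes "psd_kernel d Y" "i < d"
  shows "Im (Y i i) = 0" "0 \<le> Re (Y i i)"
proof -
  have h: "\<And>a b. a < d \<Longrightarrow> b < d \<Longrightarrow> cnj (Y a b) = Y b a"
    using psd_kernel_hermitian[OF assms(1)] .
  show "Im (Y i i) = 0" using h[OF assms(2,2)] by (simp add: complex_eq_iff)
  have "0 \<le> Re (\<Sum>a<d. \<Sum>b<d. cnj (0 + (if a = i then 1 else 0)) * Y a b
      * (0 + (if b = i then 1 else 0)))"
    by (rule psd_kernel_nonneg[OF assms(1)])
  then show "0 \<le> Re (Y i i)"
    by (subst (asm) quadratic_form_shift[OF assms]) auto
qed

text \<open>
  A zero of a nonnegative quadratic form is a minimum, so the gradient \<open>Y v\<close> vanishes there.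
\<close>

lemma psd_kernel_isotropic:
  assumes psd: "psd_kernel d Y" and zero: "Re (\<Sum>a<d. \<Sum>b<d. cnj (v a) * Y a b * v b) = 0"
    and i: "i < d"
  shows "(\<Sum>b<d. Y i b * v b) = 0"
proof -
  have h: "\<And>a b. a < d \<Longrightarrow> b < d \<Longrightarrow> cnj (Y a b) = Y b a"
    using psd_kernel_hermitian[OF psd] .
  define g where "g = (\<Sum>b<d. Y i b * v b)"
  define y where "y = Re (Y i i)"
  have y: "0 \<le> y" "Y i i = of_real y"
    using psd_kernel_diag_nonneg[OF psd i] by (auto simp: y_def complex_eq_iff)
  \<comment> \<open>A gradient step of length \<open>s\<close> changes the form by \<open>s (s y - 2) |g|\<^sup>2\<close>; the denominator \<open>y + 1\<close> keeps
    this negative also when \<open>y = 0\<close>.\<close>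
  define s where "s = 1 / (y + 1)"
  have s: "s > 0" "s * y < 1" using y by (auto simp: s_def field_simps)
  define t where "t = - of_real s * g"
  have "0 \<le> Re (\<Sum>a<d. \<Sum>b<d. cnj (v a + (if a = i then t else 0)) * Y a b
      * (v b + (if b = i then t else 0)))"
    by (rule psd_kernel_nonneg[OF psd])
  then have "0 \<le> Re (t * cnj g + cnj t * g + cnj t * t * Y i i)"
    unfolding quadratic_form_shift[OF psd i] using zero by (simp add: g_def)
  also have "\<dots> = Re (of_real (s * (s * y - 2)) * (cnj g * g))"
    unfolding t_def y(2) by (simp add: algebra_simps)
  also have "\<dots> = s * (s * y - 2) * (cmod g)\<^sup>2"
    unfolding cmod_square_eq_cnj_mult[symmetric] by (simp del: of_real_power)
  finally have "0 \<le> s * (s * y - 2) * (cmod g)\<^sup>2" .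
  moreover have "s * (s * y - 2) < 0" using s by (simp add: mult_pos_neg)
  ultimately have "(cmod g)\<^sup>2 \<le> 0" by (metis mult_less_0_iff not_le)
  then show ?thesis by (simp add: g_def)
qed

text \<open>
  The form of the Schur complement at \<open>v\<close> is the minimum of the original form over the line
  through \<open>v\<close> in direction \<open>i\<close>, and therefore nonnegative.
\<close>

lemma psd_kernel_schur_complement:
  assumes psd: "psd_kernel d Y" and i: "i < d" and nz: "Y i i \<noteq> 0"
  shows "psd_kernel d (\<lambda>a b. Y a b - Y a i * Y i b / Y i i)"
  unfolding psd_kernel_def
proof (intro conjI allI impI)
  have h: "\<And>a b. a < d \<Longrightarrow> b < d \<Longrightarrow> cnj (Y a b) = Y b a"
    using psd_kernel_hermitian[OF psd] .
  fix a b assume "a < d" "b < d"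
  then show "Y b a - Y b i * Y i a / Y i i = cnj (Y a b - Y a i * Y i b / Y i i)"
    using i by (simp add: h mult.commute)
next
  have h: "\<And>a b. a < d \<Longrightarrow> b < d \<Longrightarrow> cnj (Y a b) = Y b a"
    using psd_kernel_hermitian[OF psd] .
  fix v :: "nat \<Rightarrow> complex"
  define g where "g = (\<Sum>b<d. Y i b * v b)"
  define t where "t = - g / Y i i"
  have ct: "cnj t = - cnj g / Y i i" by (simp add: t_def h i)
  have cg: "(\<Sum>a<d. cnj (v a) * Y a i) = cnj g"
    unfolding g_def cnj_sum by (intro sum.cong refl) (simp add: h i mult.commute)
  have *: "(\<Sum>a<d. \<Sum>b<d. cnj (v a) * (Y a i * Y i b / Y i i) * v b) = cnj g * g / Y i i"
    unfolding cg[symmetric] unfolding g_def sum_product sum_divide_distrib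
    by (intro sum.cong refl) (simp add: mult_ac)
  have "0 \<le> Re (\<Sum>a<d. \<Sum>b<d. cnj (v a + (if a = i then t else 0)) * Y a b
      * (v b + (if b = i then t else 0)))"
    by (rule psd_kernel_nonneg[OF psd])
  moreover have "q + t * cnj g + cnj t * g + cnj t * t * Y i i = q - cnj g * g / Y i i" for q
    unfolding ct using nz by (simp add: t_def field_simps)
  ultimately have nonneg: "0 \<le> Re ((\<Sum>a<d. \<Sum>b<d. cnj (v a) * Y a b * v b) - cnj g * g / Y i i)"
    unfolding quadratic_form_shift[OF psd i] g_def[symmetric] by (simp only:)
  have diff: "(\<Sum>a<d. \<Sum>b<d. cnj (v a) * Y a b * v b) - cnj g * g / Y i i = (\<Sum>a<d. \<Sum>b<d. cnj (v a) * (Y a b - Y a i * Y i b / Y i i) * v b)"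
    unfolding *[symmetric] sum_subtractf[symmetric]
    by (intro sum.cong refl) (simp add: algebra_simps)
  show "0 \<le> Re (\<Sum>a<d. \<Sum>b<d. cnj (v a) * (Y a b - Y a i * Y i b / Y i i) * v b)"
    using nonneg unfolding diff .
qed

text \<open>
  Subtracting from \<open>Y\<close> the rank-one matrix \<open>w w\<^sup>* / Y\<^sub>i\<^sub>i\<close>, where \<open>w\<close> is the \<open>i\<close>-th column, splits the trace of
  \<open>X Y\<close> into the trace of \<open>X Y'\<close> with the Schur complement \<open>Y'\<close> and the nonnegative number
  \<open>w\<^sup>* X w / Y\<^sub>i\<^sub>i\<close>. If the total is \<open>0\<close>, both summands are, hence \<open>X Y' = 0\<close> by induction and \<open>X w = 0\<close>. Each
  step clears a diagonal entry and creates no new one; a positive semidefinite matrix with zero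
  diagonal is zero.
\<close>

lemma psd_kernel_product_eq_0:
  assumes X: "psd_kernel d X" and Y: "psd_kernel d Y"
    and zero: "Re (\<Sum>a<d. \<Sum>b<d. X a b * Y b a) = 0" and ab: "a < d" "b < d"
  shows "(\<Sum>c<d. X a c * Y c b) = 0"
proof -
  have "0 \<le> Re (\<Sum>a<d. \<Sum>b<d. X a b * Y b a) \<and>
     (Re (\<Sum>a<d. \<Sum>b<d. X a b * Y b a) = 0 \<longrightarrow> (\<forall>a<d. \<forall>b<d. (\<Sum>c<d. X a c * Y c b) = 0))"
    using Y
  proof (induction "card {i. i < d \<and> Y i i \<noteq> 0}" arbitrary: Y rule: less_induct)
    case less
    have hY: "\<And>a b. a < d \<Longrightarrow> b < d \<Longrightarrow> cnj (Y a b) = Y b a"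
      using psd_kernel_hermitian[OF less.prems] .
    show ?case
    proof (cases "\<exists>i<d. Y i i \<noteq> 0")
      case False
      have "Y j i = 0" if "i < d" "j < d" for i j
      proof -
        have "(\<Sum>a<d. \<Sum>b<d. cnj (if a = i then 1 else 0) * Y a b * (if b = i then 1 else 0)) = Y i i"
          using quadratic_form_shift[OF less.prems \<open>i < d\<close>, where v = "\<lambda>_. 0" and t = 1] by simp
        then have "(\<Sum>b<d. Y j b * (if b = i then 1 else 0)) = 0"
          using False that by (intro psd_kernel_isotropic[OF less.prems]) auto
        then show ?thesis by (simp only: sum_mult_delta[OF that(1)] mult_1_right)
      qed
      then show ?thesis by simp
    next
      case True
      then obtain i where i: "i < d" "Y i i \<noteq> 0" by blast
      define Y' where "Y' a b = Y a b - Y a i * Y i b / Y i i" for a b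
      have psd': "psd_kernel d Y'"
        using psd_kernel_schur_complement[of d Y i] less.prems i by (simp add: Y'_def[abs_def])
      define r where "r = Re (Y i i)"
      have r: "r > 0" "Y i i = of_real r"
        using psd_kernel_diag_nonneg[OF less.prems i(1)] i(2)
        by (auto simp: r_def complex_eq_iff)
      have "{j. j < d \<and> Y' j j \<noteq> 0} \<subset> {j. j < d \<and> Y j j \<noteq> 0}"
      proof
        show "{j. j < d \<and> Y' j j \<noteq> 0} \<subseteq> {j. j < d \<and> Y j j \<noteq> 0}"
        proof clarify
          fix j assume j: "j < d" and nz': "Y' j j \<noteq> 0" and z: "Y j j = 0"
          have "Y' j j = - (cnj (Y i j) * Y i j) / of_real r"
            by (simp add: Y'_def z hY i j flip: r(2))
          also have "\<dots> = of_real (- (cmod (Y i j))\<^sup>2 / r)"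
            unfolding cmod_square_eq_cnj_mult[symmetric] by simp
          finally have eq: "Y' j j = of_real (- (cmod (Y i j))\<^sup>2 / r)" .
          then have "(cmod (Y i j))\<^sup>2 / r \<le> 0"
            using psd_kernel_diag_nonneg(2)[OF psd' j] by simp
          then have "(cmod (Y i j))\<^sup>2 = 0" using r(1) by (simp add: divide_le_0_iff)
          then show False using eq nz' by simp
        qed
        have "Y' i i = 0" using i by (simp add: Y'_def)
        then show "{j. j < d \<and> Y' j j \<noteq> 0} \<noteq> {j. j < d \<and> Y j j \<noteq> 0}" using i by blast
      qed
      then have "card {j. j < d \<and> Y' j j \<noteq> 0} < card {j. j < d \<and> Y j j \<noteq> 0}"
        by (intro psubset_card_mono) auto
      note IH = less.hyps[OF this psd']
      define w where "w a = Y a i" for a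
      have split: "(\<Sum>a<d. \<Sum>b<d. X a b * Y b a) = (\<Sum>a<d. \<Sum>b<d. X a b * Y' b a)
          + (\<Sum>a<d. \<Sum>b<d. cnj (w a) * X a b * w b) / of_real r"
      proof -
        have "(\<Sum>a<d. \<Sum>b<d. cnj (w a) * X a b * w b) / of_real r
            = (\<Sum>a<d. \<Sum>b<d. X a b * (Y b i * Y i a / Y i i))"
          unfolding sum_divide_distrib r(2) w_def
          by (intro sum.cong refl) (simp add: hY i mult_ac)
        then show ?thesis
          unfolding sum.distrib[symmetric]
          by (simp only: sum.distrib[symmetric]) (intro sum.cong refl, simp add: Y'_def algebra_simps)
      qed
      have q: "0 \<le> Re (\<Sum>a<d. \<Sum>b<d. cnj (w a) * X a b * w b)"
        by (rule psd_kernel_nonneg[OF X])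
      have re: "Re (\<Sum>a<d. \<Sum>b<d. X a b * Y b a) = Re (\<Sum>a<d. \<Sum>b<d. X a b * Y' b a)
          + Re (\<Sum>a<d. \<Sum>b<d. cnj (w a) * X a b * w b) / r"
        unfolding split by (simp add: Re_divide_of_real)
      have q': "0 \<le> Re (\<Sum>a<d. \<Sum>b<d. cnj (w a) * X a b * w b) / r" using q r(1) by simp
      show ?thesis
      proof (intro conjI impI allI)
        show "0 \<le> Re (\<Sum>a<d. \<Sum>b<d. X a b * Y b a)" using re q' IH by linarith
        assume "Re (\<Sum>a<d. \<Sum>b<d. X a b * Y b a) = 0"
        then have z1: "Re (\<Sum>a<d. \<Sum>b<d. X a b * Y' b a) = 0"
          and "Re (\<Sum>a<d. \<Sum>b<d. cnj (w a) * X a b * w b) / r = 0"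
          using re q' IH by linarith+
        then have z2: "Re (\<Sum>a<d. \<Sum>b<d. cnj (w a) * X a b * w b) = 0" using r(1) by simp
        fix a b assume ab: "a < d" "b < d"
        have eq: "(\<Sum>c<d. X a c * Y c b) = (\<Sum>c<d. X a c * Y' c b) + (\<Sum>c<d. X a c * w c) * (Y i b / Y i i)"
          unfolding sum_distrib_right sum.distrib[symmetric]
          by (intro sum.cong refl) (simp add: Y'_def w_def algebra_simps)
        have "(\<Sum>c<d. X a c * Y' c b) = 0" using IH z1 ab by blast
        moreover have "(\<Sum>c<d. X a c * w c) = 0" using psd_kernel_isotropic[OF X z2 ab(1)] .
        ultimately show "(\<Sum>c<d. X a c * Y c b) = 0" unfolding eq by simp
      qed
    qed
  qed
  then show ?thesis using zero ab by blast
qed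

lemma hermitian_psd_kernel:
  assumes "hermitian_psd d A"
  shows "psd_kernel d (\<lambda>a b. A $$ (a, b))"
  unfolding psd_kernel_def
proof (intro conjI allI impI)
  have A: "A \<in> carrier_mat d d" "mat_adjoint A = A" using assms unfolding hermitian_psd_def by auto
  fix a b assume "a < d" "b < d"
  then show "A $$ (b, a) = cnj (A $$ (a, b))" using mat_adjoint_index[of b A a] A by simp
next
  have A: "A \<in> carrier_mat d d" using assms unfolding hermitian_psd_def by auto
  fix v :: "nat \<Rightarrow> complex"
  have "(A *\<^sub>v vec d v) \<bullet>c vec d v = (\<Sum>a<d. \<Sum>b<d. cnj (v a) * A $$ (a, b) * v b)"
    using A by (simp add: scalar_prod_def atLeast0LessThan sum_distrib_left mult_ac
        conjugate_complex_def)
  moreover have "0 \<le> (A *\<^sub>v vec d v) \<bullet>c vec d v"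
    using assms unfolding hermitian_psd_def by simp
  ultimately show "0 \<le> Re (\<Sum>a<d. \<Sum>b<d. cnj (v a) * A $$ (a, b) * v b)"
    by (simp add: less_eq_complex_def)
qed

lemma psd_orthogonal_mult_eq_0:
  assumes "hermitian_psd d X" "hermitian_psd d Y" "trace_inner X Y = 0"
  shows "X * Y = 0\<^sub>m d d"
proof -
  have c: "X \<in> carrier_mat d d" "Y \<in> carrier_mat d d" "mat_adjoint X = X"
    using assms unfolding hermitian_psd_def by auto
  have z: "(\<Sum>a<d. \<Sum>b<d. X $$ (a, b) * Y $$ (b, a)) = 0"
    using assms(3) c by (simp add: trace_inner_hermitian mat_trace_mult)
  have "(\<Sum>e<d. X $$ (a, e) * Y $$ (e, b)) = 0" if "a < d" "b < d" for a b
    by (rule psd_kernel_product_eq_0[OF hermitian_psd_kernel[OF assms(1)]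
          hermitian_psd_kernel[OF assms(2)] _ that]) (simp add: z)
  then show ?thesis
    using c by (intro eq_matI) (auto simp: scalar_prod_def atLeast0LessThan)
qed


section \<open>Anticommuting families need exponential dimension\<close>

primrec clifford_monomial :: "nat \<Rightarrow> (nat \<Rightarrow> complex mat) \<Rightarrow> nat set \<Rightarrow> nat \<Rightarrow> complex mat" where
  "clifford_monomial d A I 0 = 1\<^sub>m d"
| "clifford_monomial d A I (Suc m) =
     (if m \<in> I then clifford_monomial d A I m * A m else clifford_monomial d A I m)"

text \<open>
  Generators of a Clifford algebra whose unit is replaced by \<open>K\<^sup>2\<close>. A positive multiple of the
  identity for \<open>K\<close> gives the usual relations; a factorization only yields some self-adjoint \<open>K\<close> that
  commutes with the generators and may be singular.
\<close>

locale clifford_family =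
  fixes d n :: nat and A :: "nat \<Rightarrow> complex mat" and K :: "complex mat"
  assumes A_carrier: "\<And>i. i < n \<Longrightarrow> A i \<in> carrier_mat d d"
    and K_carrier: "K \<in> carrier_mat d d"
    and A_adjoint: "\<And>i. i < n \<Longrightarrow> mat_adjoint (A i) = A i"
    and K_adjoint: "mat_adjoint K = K"
    and A_square: "\<And>i. i < n \<Longrightarrow> A i * A i = K * K"
    and A_K_commute: "\<And>i. i < n \<Longrightarrow> A i * K = K * A i"
    and anticommute: "\<And>i j. i < n \<Longrightarrow> j < n \<Longrightarrow> i \<noteq> j \<Longrightarrow> A i * A j = - (A j * A i)"
begin

abbreviation monomial :: "nat set \<Rightarrow> nat \<Rightarrow> complex mat" where
  "monomial \<equiv> clifford_monomial d A"

lemma monomial_carrier: "m \<le> n \<Longrightarrow> monomial I m \<in> carrier_mat d d"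
proof (induction m)
  case (Suc m)
  then show ?case using A_carrier[of m] by (auto intro!: mult_carrier_mat)
qed simp

lemma monomial_K_commute: "m \<le> n \<Longrightarrow> monomial I m * K = K * monomial I m"
proof (induction m)
  case 0
  then show ?case using K_carrier by simp
next
  case (Suc m)
  then have m: "m < n" by simp
  note c = monomial_carrier[of m I] A_carrier[OF m] K_carrier
  have "monomial I m * A m * K = K * (monomial I m * A m)"
  proof -
    have "monomial I m * A m * K = monomial I m * (K * A m)"
      using c m by (simp add: assoc_mult_mat[of _ d d _ d _ d] A_K_commute)
    also have "\<dots> = K * monomial I m * A m"
      using m Suc.IH by (simp add: assoc_mult_mat[OF c(1,3,2), symmetric])
    also have "\<dots> = K * (monomial I m * A m)"
      using c m by (simp add: assoc_mult_mat[of _ d d _ d _ d])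
    finally show ?thesis .
  qed
  then show ?case using Suc by simp
qed

text \<open>
  Moving \<open>A i\<close> past a monomial costs one sign for every factor different from \<open>A i\<close>.
\<close>

lemma monomial_sign:
  assumes i: "i < n"
  shows "m \<le> n \<Longrightarrow> A i * monomial I m = (- 1) ^ card (I \<inter> {..<m} - {i}) \<cdot>\<^sub>m (monomial I m * A i)"
proof (induction m)
  case 0
  then show ?case using A_carrier[OF i] by (auto intro!: eq_matI)
next
  case (Suc m)
  then have m: "m < n" by simp
  define s :: complex where "s = (- 1) ^ card (I \<inter> {..<m} - {i})"
  have c: "monomial I m \<in> carrier_mat d d" "A m \<in> carrier_mat d d" "A i \<in> carrier_mat d d"
    using monomial_carrier[of m I] A_carrier m i by auto
  have cAA: "A i * A m \<in> carrier_mat d d" "A m * A i \<in> carrier_mat d d" using c by auto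
  have IH: "A i * monomial I m = s \<cdot>\<^sub>m (monomial I m * A i)" using Suc m by (simp add: s_def)
  show ?case
  proof (cases "m \<in> I")
    case False
    then have "I \<inter> {..<Suc m} = I \<inter> {..<m}" by (auto simp: less_Suc_eq)
    then show ?thesis using False IH by (simp add: s_def)
  next
    case True
    have "A i * (monomial I m * A m) = (A i * monomial I m) * A m"
      using c by (simp add: assoc_mult_mat[of _ d d _ d _ d])
    also have "\<dots> = s \<cdot>\<^sub>m (monomial I m * (A i * A m))"
      unfolding IH using c
      by (simp add: mult_smult_assoc_mat[of _ d d _ d] assoc_mult_mat[of _ d d _ d _ d])
    finally have eq: "A i * (monomial I m * A m) = s \<cdot>\<^sub>m (monomial I m * (A i * A m))" .
    show ?thesis
    proof (cases "i = m")
      case eq_im: True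
      have "I \<inter> {..<Suc m} - {i} = I \<inter> {..<m} - {i}" using eq_im by (auto simp: less_Suc_eq)
      then show ?thesis using True eq eq_im c
        by (simp add: s_def assoc_mult_mat[of _ d d _ d _ d])
    next
      case False
      have "I \<inter> {..<Suc m} - {i} = insert m (I \<inter> {..<m} - {i})"
        using True False by (auto simp: less_Suc_eq)
      then have "(- 1) ^ card (I \<inter> {..<Suc m} - {i}) = - s" by (simp add: s_def)
      moreover have "s \<cdot>\<^sub>m (monomial I m * (A i * A m)) = - s \<cdot>\<^sub>m (monomial I m * A m * A i)"
      proof -
        have "monomial I m * (A i * A m) = - (monomial I m * (A m * A i))"
          using c cAA by (simp add: anticommute[OF i m False])
        also have "\<dots> = - (monomial I m * A m * A i)"
          using c by (simp add: assoc_mult_mat[of _ d d _ d _ d])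
        finally show ?thesis by (auto intro!: eq_matI)
      qed
      ultimately show ?thesis using True eq by simp
    qed
  qed
qed

text \<open>
  \<open>K\<close> and \<open>K\<^sup>2\<close> have the same kernel because \<open>K\<close> is self-adjoint.
\<close>

lemma mult_K_cancel:
  assumes Z: "Z \<in> carrier_mat d d" and "Z * K * K = 0\<^sub>m d d"
  shows "Z * K = 0\<^sub>m d d"
proof (rule trace_inner_self_eq_0D)
  note c = Z K_carrier mat_adjoint_carrier[OF Z]
  show "Z * K \<in> carrier_mat d d" using c by auto
  have "trace_inner (Z * K) (Z * K) = mat_trace (mat_adjoint Z * (Z * K * K))"
    using c by (simp add: trace_inner_mult_right[OF Z Z K_carrier K_adjoint]
        assoc_mult_mat[of _ d d _ d _ d])
  also have "\<dots> = mat_trace (0\<^sub>m d d)"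
    by (simp only: assms(2) right_mult_zero_mat[OF c(3)])
  also have "\<dots> = 0" by (simp add: mat_trace_def)
  finally show "trace_inner (Z * K) (Z * K) = 0" .
qed

text \<open>
  The generators cannot be cancelled directly, as they may be singular. Multiplying once more by
  the last generator turns it into a power of \<open>K\<close>, which \<open>mult_K_cancel\<close> reduces to the first power.
\<close>

lemma monomial_K_eq_0D:
  "m \<le> n \<Longrightarrow> monomial I m * K = 0\<^sub>m d d \<Longrightarrow> K = 0\<^sub>m d d"
proof (induction m)
  case 0
  then show ?case using K_carrier by simp
next
  case (Suc m)
  then have m: "m < n" by simp
  show ?case
  proof (cases "m \<in> I")
    case False
    then show ?thesis using Suc by simp
  next
    case True
    have c: "monomial I m \<in> carrier_mat d d" "A m \<in> carrier_mat d d" "K \<in> carrier_mat d d"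
      using monomial_carrier[of m I] A_carrier[OF m] K_carrier m by auto
    have "monomial I m * K * K * K = monomial I m * (A m * A m * K)"
      using c by (simp add: A_square[OF m] assoc_mult_mat[of _ d d _ d _ d])
    also have "A m * A m * K = A m * K * A m"
      using assoc_mult_mat[OF c(2,2,3)] assoc_mult_mat[OF c(2,3,2)] A_K_commute[OF m] by metis
    also have "monomial I m * (A m * K * A m) = (monomial I m * A m * K) * A m"
      using c by (simp add: assoc_mult_mat[of _ d d _ d _ d])
    also have "\<dots> = 0\<^sub>m d d" using Suc.prems True c by simp
    finally have "monomial I m * K * K * K = 0\<^sub>m d d" .
    then have "monomial I m * K * K = 0\<^sub>m d d"
      by (rule mult_K_cancel[OF mult_carrier_mat[OF c(1,3)]])
    then have "monomial I m * K = 0\<^sub>m d d"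
      by (rule mult_K_cancel[OF c(1)])
    then show ?thesis using Suc by simp
  qed
qed

text \<open>
  Since \<open>A i\<close> and \<open>K\<close> have the same square, the factor \<open>K\<close> may be replaced by \<open>A i\<close>, on either side. Going
  from the left to the right costs the product of the two signs.
\<close>

lemma monomial_inner_sign:
  assumes "i < n"
  shows "trace_inner (monomial I n * K) (monomial J n * K) =
    (- 1) ^ (card (I \<inter> {..<n} - {i}) + card (J \<inter> {..<n} - {i})) * trace_inner (monomial I n * K) (monomial J n * K)"
proof -
  have c: "monomial I n \<in> carrier_mat d d" "monomial J n \<in> carrier_mat d d" by (auto intro: monomial_carrier)
  note A = A_carrier[OF assms] A_adjoint[OF assms]
  note K = K_carrier K_adjoint
  have "trace_inner (monomial I n * K) (monomial J n * K) = trace_inner (A i * monomial I n) (A i * monomial J n)"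
    by (simp add: monomial_K_commute trace_inner_mult_left[OF c K] trace_inner_mult_left[OF c A]
        A_square[OF assms])
  also have "\<dots> = (- 1) ^ (card (I \<inter> {..<n} - {i}) + card (J \<inter> {..<n} - {i}))
      * trace_inner (monomial I n * A i) (monomial J n * A i)"
    using c A by (simp add: monomial_sign[OF assms] trace_inner_smult[of _ d] power_add)
  also have "trace_inner (monomial I n * A i) (monomial J n * A i) = trace_inner (monomial I n * K) (monomial J n * K)"
    by (simp add: trace_inner_mult_right[OF c K] trace_inner_mult_right[OF c A] A_square[OF assms])
  finally show ?thesis .
qed

text \<open>
  It suffices to find \<open>i\<close> for which the sign in \<open>monomial_inner_sign\<close> is \<open>-1\<close>. If \<open>I\<close> and \<open>J\<close> have cardinalities
  of the same parity, any \<open>i\<close> in exactly one of them works. Otherwise any \<open>i\<close> in both or in neither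
  works; one exists because complementary subsets of a set of even size have the same parity.
\<close>

lemma monomials_orthogonal:
  assumes "even n" "I \<subseteq> {..<n}" "J \<subseteq> {..<n}" "I \<noteq> J"
  shows "trace_inner (monomial I n * K) (monomial J n * K) = 0"
proof -
  have fin: "finite I" "finite J" using finite_subset[OF assms(2)] finite_subset[OF assms(3)] by simp_all
  have "\<exists>i<n. odd (card (I - {i}) + card (J - {i}))"
  proof (cases "even (card I + card J)")
    case True
    obtain i where i: "i \<in> I \<and> i \<notin> J \<or> i \<in> J \<and> i \<notin> I" using assms(4) by blast
    then have "Suc (card (I - {i}) + card (J - {i})) = card I + card J"
    proof (elim disjE conjE)
      assume "i \<in> I" "i \<notin> J"
      then show ?thesis using card_Suc_Diff1[OF fin(1)] by fastforce
    next
      assume "i \<in> J" "i \<notin> I"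
      then show ?thesis using card_Suc_Diff1[OF fin(2)] by fastforce
    qed
    then have "odd (card (I - {i}) + card (J - {i}))" using True by (metis even_Suc)
    moreover have "i < n" using i assms by auto
    ultimately show ?thesis by blast
  next
    case False
    have "\<exists>i<n. i \<in> I \<longleftrightarrow> i \<in> J"
    proof (rule ccontr)
      assume "\<not> ?thesis"
      then have "J = {..<n} - I" using assms by blast
      then have "card I + card J = n"
        using card_Diff_subset[OF fin(1) assms(2)] card_mono[OF _ assms(2)] by simp
      then show False using False assms(1) by simp
    qed
    then obtain i where i: "i < n" "i \<in> I \<longleftrightarrow> i \<in> J" by blast
    have "odd (card (I - {i}) + card (J - {i}))"
    proof (cases "i \<in> I")
      case True
      then have "card I + card J = card (I - {i}) + card (J - {i}) + 2"
        using i card_Suc_Diff1[OF fin(1), of i] card_Suc_Diff1[OF fin(2), of i] by linarith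
      then show ?thesis using False by simp
    qed (use i False in simp)
    then show ?thesis using i(1) by blast
  qed
  then obtain i where i: "i < n" "odd (card (I - {i}) + card (J - {i}))" by blast
  have "I \<inter> {..<n} = I" "J \<inter> {..<n} = J" using assms by auto
  then have "trace_inner (monomial I n * K) (monomial J n * K) = - trace_inner (monomial I n * K) (monomial J n * K)"
    using monomial_inner_sign[OF i(1), of I J] i(2) by simp
  then show ?thesis by simp
qed

text \<open>
  The matrices \<open>monomial I n * K\<close>, one for each subset \<open>I\<close> of \<open>{..<n}\<close>, form an orthogonal family of
  nonzero vectors in the space of matrices, whose dimension is \<open>d * d\<close>.
\<close>

lemma dimension_bound:
  assumes "even n" "K \<noteq> 0\<^sub>m d d"
  shows "2 ^ n \<le> d * d"
proof -
  define w where "w I p = (monomial I n * K) $$ p" for I p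
  have c: "monomial I n * K \<in> carrier_mat d d" for I
    by (rule mult_carrier_mat[OF monomial_carrier K_carrier]) simp
  have "card (Pow {..<n}) \<le> card ({..<d} \<times> {..<d})"
  proof (rule card_orthogonal_family_le[where w = w])
    fix I J assume "I \<in> Pow {..<n}" "J \<in> Pow {..<n}" "I \<noteq> J"
    then have "trace_inner (monomial I n * K) (monomial J n * K) = 0"
      using monomials_orthogonal[OF assms(1), of I J] by simp
    then show "(\<Sum>b\<in>{..<d} \<times> {..<d}. cnj (w I b) * w J b) = 0"
      unfolding trace_inner_entries[OF c c] sum.cartesian_product' w_def .
  next
    fix I
    show "\<exists>b\<in>{..<d} \<times> {..<d}. w I b \<noteq> 0"
    proof (rule ccontr)
      assume "\<not> ?thesis"
      then have "(monomial I n * K) $$ (a, b) = 0" if "a < d" "b < d" for a b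
        using that by (simp add: w_def del: index_mult_mat(1))
      then have "monomial I n * K = 0\<^sub>m d d"
        using carrier_matD[OF c[of I]] by (intro eq_matI) simp_all
      then show False using monomial_K_eq_0D[of n I] assms by simp
    qed
  qed auto
  then show ?thesis by (simp add: card_Pow)
qed

end


section \<open>Clifford generators of size \<open>2\<^sup>k\<close>\<close>

lemma mat_adjoint_four_block:
  fixes P Q R S :: "complex mat"
  assumes "P \<in> carrier_mat e e" "Q \<in> carrier_mat e e" "R \<in> carrier_mat e e" "S \<in> carrier_mat e e"
  shows "mat_adjoint (four_block_mat P Q R S)
       = four_block_mat (mat_adjoint P) (mat_adjoint R) (mat_adjoint Q) (mat_adjoint S)"
  using assms by (intro eq_matI) auto

lemma uminus_four_block:
  fixes P Q R S :: "complex mat"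
  assumes "P \<in> carrier_mat e e" "Q \<in> carrier_mat e e" "R \<in> carrier_mat e e" "S \<in> carrier_mat e e"
  shows "- four_block_mat P Q R S = four_block_mat (- P) (- Q) (- R) (- S)"
  using assms by (intro eq_matI) auto

lemma mat_adjoint_uminus: "mat_adjoint (- P :: complex mat) = - mat_adjoint P"
  by (intro eq_matI) auto

lemma mat_adjoint_smult: "mat_adjoint (c \<cdot>\<^sub>m P :: complex mat) = cnj c \<cdot>\<^sub>m mat_adjoint P"
  by (intro eq_matI) auto

lemma mat_adjoint_add:
  fixes P Q :: "complex mat"
  assumes "P \<in> carrier_mat e e" "Q \<in> carrier_mat e e"
  shows "mat_adjoint (P + Q) = mat_adjoint P + mat_adjoint Q"
  using assms by (intro eq_matI) auto

lemma mat_adjoint_minus: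
  fixes P Q :: "complex mat"
  assumes "P \<in> carrier_mat e e" "Q \<in> carrier_mat e e"
  shows "mat_adjoint (P - Q) = mat_adjoint P - mat_adjoint Q"
  using assms by (intro eq_matI) auto

lemma smult_smult_mat: "a \<cdot>\<^sub>m (b \<cdot>\<^sub>m P :: complex mat) = (a * b) \<cdot>\<^sub>m P"
  by (intro eq_matI) auto

lemma mat_adjoint_one: "mat_adjoint (1\<^sub>m e :: complex mat) = 1\<^sub>m e"
  by (intro eq_matI) auto

lemma mat_adjoint_zero: "mat_adjoint (0\<^sub>m e e :: complex mat) = 0\<^sub>m e e"
  by (intro eq_matI) auto

text \<open>
  The Jordan-Wigner construction: with the Pauli matrices \<open>\<sigma>\<close>, the generators \<open>\<gamma>\<^sub>i\<close> become
  \<open>\<sigma>\<^sub>z \<otimes> \<gamma>\<^sub>i\<close>, and \<open>\<sigma>\<^sub>x \<otimes> 1\<close> and \<open>\<sigma>\<^sub>y \<otimes> 1\<close> are two new ones, while the size doubles.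
\<close>

lemma clifford_family_exists:
  "\<exists>\<gamma>. clifford_family (2 ^ k) (2 * k) \<gamma> (1\<^sub>m (2 ^ k))"
proof (induction k)
  case 0
  have "clifford_family (2 ^ 0) (2 * 0) (\<lambda>_. 1\<^sub>m (2 ^ 0)) (1\<^sub>m (2 ^ 0))"
    by unfold_locales (auto simp: mat_adjoint_one)
  then show ?case by blast
next
  case (Suc k)
  define e :: nat where "e = 2 ^ k"
  from Suc obtain \<gamma> where "clifford_family e (2 * k) \<gamma> (1\<^sub>m e)" by (auto simp: e_def)
  then interpret clifford_family e "2 * k" \<gamma> "1\<^sub>m e" .
  define X where "X = four_block_mat (0\<^sub>m e e) (1\<^sub>m e) (1\<^sub>m e) (0\<^sub>m e e :: complex mat)"
  define Y where "Y = four_block_mat (0\<^sub>m e e) (- \<i> \<cdot>\<^sub>m 1\<^sub>m e) (\<i> \<cdot>\<^sub>m 1\<^sub>m e) (0\<^sub>m e e)"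
  define Z where "Z i = four_block_mat (\<gamma> i) (0\<^sub>m e e) (0\<^sub>m e e) (- \<gamma> i)" for i
  define \<gamma>' where "\<gamma>' i = (if i < 2 * k then Z i else if i = 2 * k then X else Y)" for i
  have negz: "- 0\<^sub>m e e = (0\<^sub>m e e :: complex mat)" by (intro eq_matI) auto
  have negs: "- (c \<cdot>\<^sub>m P) = (- c) \<cdot>\<^sub>m P" "c \<cdot>\<^sub>m (- P) = (- c) \<cdot>\<^sub>m P" for c and P :: "complex mat"
    by (intro eq_matI; simp)+
  note fb = mult_four_block_mat[of _ e e _ e _ e _ _ e _ e] negz negs
    mult_smult_assoc_mat[of _ e e _ e] mult_smult_distrib[of _ e e _ e] smult_smult_mat
  have one: "four_block_mat (1\<^sub>m e) (0\<^sub>m e e) (0\<^sub>m e e) (1\<^sub>m e) = (1\<^sub>m (e + e) :: complex mat)"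
    by simp
  have cX: "X \<in> carrier_mat (e + e) (e + e)" and cY: "Y \<in> carrier_mat (e + e) (e + e)"
    by (simp_all add: X_def Y_def)
  have cZ: "Z i \<in> carrier_mat (e + e) (e + e)" if "i < 2 * k" for i
    using A_carrier[OF that] by (simp add: Z_def)
  have hX: "mat_adjoint X = X"
    by (simp add: X_def mat_adjoint_four_block[of _ e] mat_adjoint_one mat_adjoint_zero)
  have hY: "mat_adjoint Y = Y"
    by (simp add: Y_def mat_adjoint_four_block[of _ e] mat_adjoint_one mat_adjoint_zero
        mat_adjoint_smult)
  have hZ: "mat_adjoint (Z i) = Z i" if "i < 2 * k" for i
    using A_carrier[OF that]
    by (simp add: Z_def mat_adjoint_four_block[of _ e] mat_adjoint_zero A_adjoint[OF that]
        mat_adjoint_uminus)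
  have unit: "1 \<cdot>\<^sub>m 1\<^sub>m e = (1\<^sub>m e :: complex mat)" by (intro eq_matI) auto
  have XX: "X * X = 1\<^sub>m (e + e)"
    by (simp add: X_def fb one del: four_block_one_mat)
  have YY: "Y * Y = 1\<^sub>m (e + e)"
    by (simp add: Y_def fb one unit)
  have ZZ: "Z i * Z i = 1\<^sub>m (e + e)" if "i < 2 * k" for i
    using A_carrier[OF that] A_square[OF that] by (simp add: Z_def fb one)
  have XY: "X * Y = - (Y * X)"
    by (simp add: X_def Y_def fb uminus_four_block[of _ e])
  have ZX: "Z i * X = - (X * Z i)" if "i < 2 * k" for i
    using A_carrier[OF that] by (simp add: X_def Z_def fb uminus_four_block[of _ e])
  have ZY: "Z i * Y = - (Y * Z i)" if "i < 2 * k" for i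
    using A_carrier[OF that] by (simp add: Y_def Z_def fb uminus_four_block[of _ e])
  have ZZ': "Z i * Z j = - (Z j * Z i)" if "i < 2 * k" "j < 2 * k" "i \<noteq> j" for i j
    using A_carrier[OF that(1)] A_carrier[OF that(2)] anticommute[OF that]
    by (simp add: Z_def fb uminus_four_block[of _ e])
  have anti: "\<gamma>' i * \<gamma>' j = - (\<gamma>' j * \<gamma>' i)" if ij: "i < j" "j < 2 * Suc k" for i j
  proof -
    consider "j < 2 * k" | "j = 2 * k" | "j = Suc (2 * k)" "i < 2 * k" | "j = Suc (2 * k)" "i = 2 * k"
      using ij by fastforce
    then show ?thesis
    proof cases
      case 1
      then show ?thesis using ZZ'[of i j] ij by (simp add: \<gamma>'_def)
    next
      case 2
      then show ?thesis using ZX[of i] ij by (simp add: \<gamma>'_def)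
    next
      case 3
      then show ?thesis using ZY[of i] by (simp add: \<gamma>'_def)
    next
      case 4
      then show ?thesis using XY by (simp add: \<gamma>'_def)
    qed
  qed
  have "clifford_family (e + e) (2 * Suc k) \<gamma>' (1\<^sub>m (e + e))"
  proof
    show c': "\<gamma>' i \<in> carrier_mat (e + e) (e + e)" for i
      using cX cY cZ by (simp add: \<gamma>'_def)
    show "mat_adjoint (\<gamma>' i) = \<gamma>' i" for i
      using hX hY hZ by (simp add: \<gamma>'_def)
    show "\<gamma>' i * \<gamma>' i = 1\<^sub>m (e + e) * 1\<^sub>m (e + e)" for i
      using XX YY ZZ by (simp add: \<gamma>'_def)
    show "\<gamma>' i * 1\<^sub>m (e + e) = 1\<^sub>m (e + e) * \<gamma>' i" for i
      by (simp only: left_mult_one_mat[OF c'] right_mult_one_mat[OF c'])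
    fix i j assume "i < 2 * Suc k" "j < 2 * Suc k" "i \<noteq> j"
    then consider "i < j" "j < 2 * Suc k" | "j < i" "i < 2 * Suc k" by linarith
    then show "\<gamma>' i * \<gamma>' j = - (\<gamma>' j * \<gamma>' i)"
    proof cases
      case 1
      then show ?thesis by (rule anti)
    next
      case 2
      show ?thesis unfolding anti[OF 2] by simp
    qed
  qed (simp_all add: mat_adjoint_one)
  then show ?case by (auto simp: e_def mult_2)
qed

section \<open>Spectral projections of reflections\<close>

text \<open>
  For self-adjoint \<open>C\<close> with \<open>C * C = 1\<close> this is the orthogonal projection onto an eigenspace of \<open>C\<close>, for
  the eigenvalue \<open>1\<close> if \<open>s\<close> holds and \<open>-1\<close> otherwise.
\<close>

definition spectral_projection :: "nat \<Rightarrow> complex mat \<Rightarrow> bool \<Rightarrow> complex mat" where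
  "spectral_projection d C s = (1 / 2) \<cdot>\<^sub>m (1\<^sub>m d + (if s then 1 else - 1) \<cdot>\<^sub>m C)"

lemma spectral_projection_carrier [simp]:
  "C \<in> carrier_mat d d \<Longrightarrow> spectral_projection d C s \<in> carrier_mat d d"
  by (simp add: spectral_projection_def)

lemma spectral_projection_mult:
  assumes C: "C \<in> carrier_mat d d" and "C * C = 1\<^sub>m d"
  shows "spectral_projection d C s * spectral_projection d C t
       = (if s = t then spectral_projection d C s else 0\<^sub>m d d)"
proof -
  define x :: complex where "x = (if s then 1 else - 1)"
  define y :: complex where "y = (if t then 1 else - 1)"
  have "(1\<^sub>m d + x \<cdot>\<^sub>m C) * (1\<^sub>m d + y \<cdot>\<^sub>m C) = (1 + x * y) \<cdot>\<^sub>m 1\<^sub>m d + (x + y) \<cdot>\<^sub>m C"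
  proof -
    have "(1\<^sub>m d + x \<cdot>\<^sub>m C) * (1\<^sub>m d + y \<cdot>\<^sub>m C) = (1\<^sub>m d + x \<cdot>\<^sub>m C) + y \<cdot>\<^sub>m (C + x \<cdot>\<^sub>m (C * C))"
      using C by (simp add: add_mult_distrib_mat[of _ d d _ _ d] mult_add_distrib_mat[of _ d d _ d]
          mult_smult_assoc_mat[of _ d d _ d] mult_smult_distrib[of _ d d _ d])
    also have "\<dots> = (1 + x * y) \<cdot>\<^sub>m 1\<^sub>m d + (x + y) \<cdot>\<^sub>m C"
      unfolding assms(2) using C by (intro eq_matI) (auto simp: algebra_simps)
    finally show ?thesis .
  qed
  then have "spectral_projection d C s * spectral_projection d C t
      = (1 / 4) \<cdot>\<^sub>m ((1 + x * y) \<cdot>\<^sub>m 1\<^sub>m d + (x + y) \<cdot>\<^sub>m C)"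
    using C by (simp add: spectral_projection_def x_def y_def mult_smult_assoc_mat[of _ d d _ d]
        mult_smult_distrib[of _ d d _ d] smult_smult_mat)
  also have "\<dots> = (if s = t then spectral_projection d C s else 0\<^sub>m d d)"
    using C by (intro eq_matI) (auto simp: spectral_projection_def x_def y_def field_simps)
  finally show ?thesis .
qed

lemma spectral_projection_adjoint:
  assumes "C \<in> carrier_mat d d" "mat_adjoint C = C"
  shows "mat_adjoint (spectral_projection d C s) = spectral_projection d C s"
  using assms
  by (simp add: spectral_projection_def mat_adjoint_smult mat_adjoint_add[of _ d] mat_adjoint_one)

text \<open>
  The quadratic form of an orthogonal projection is \<open>v\<^sup>* P v = |P v|\<^sup>2\<close>.
\<close>

lemma hermitian_idempotent_psd:
  assumes P: "P \<in> carrier_mat d d" and h: "mat_adjoint P = P" and "P * P = P"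
  shows "hermitian_psd d P"
  unfolding hermitian_psd_def
proof (intro conjI ballI P h)
  fix v :: "complex vec" assume v: "v \<in> carrier_vec d"
  have herm: "cnj (P $$ (a, b)) = P $$ (b, a)" if "a < d" "b < d" for a b
    using mat_adjoint_index[of b P a] P h that by simp
  have idem: "P $$ (a, b) = (\<Sum>c<d. P $$ (a, c) * P $$ (c, b))" if "a < d" "b < d" for a b
  proof -
    have "(P * P) $$ (a, b) = (\<Sum>c<d. P $$ (a, c) * P $$ (c, b))"
      using that P by (simp add: scalar_prod_def atLeast0LessThan)
    then show ?thesis using assms(3) by simp
  qed
  define g where "g c = (\<Sum>b<d. P $$ (c, b) * v $ b)" for c
  have "(P *\<^sub>v v) \<bullet>c v = (\<Sum>a<d. \<Sum>b<d. P $$ (a, b) * v $ b * cnj (v $ a))"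
    using P v by (simp add: scalar_prod_def atLeast0LessThan sum_distrib_right conjugate_complex_def)
  also have "\<dots> = (\<Sum>a<d. \<Sum>b<d. \<Sum>c<d. cnj (P $$ (c, a) * v $ a) * (P $$ (c, b) * v $ b))"
  proof (intro sum.cong refl)
    fix a b assume ab: "a \<in> {..<d}" "b \<in> {..<d}"
    have "P $$ (a, b) * v $ b * cnj (v $ a) = (\<Sum>c<d. P $$ (a, c) * P $$ (c, b)) * v $ b * cnj (v $ a)"
      by (subst idem[of a b]) (use ab in auto)
    also have "\<dots> = (\<Sum>c<d. cnj (P $$ (c, a) * v $ a) * (P $$ (c, b) * v $ b))"
      unfolding sum_distrib_right by (intro sum.cong refl) (use ab in \<open>simp add: herm mult_ac\<close>)
    finally show "P $$ (a, b) * v $ b * cnj (v $ a) = \<dots>" .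
  qed
  also have "\<dots> = (\<Sum>a<d. \<Sum>c<d. \<Sum>b<d. cnj (P $$ (c, a) * v $ a) * (P $$ (c, b) * v $ b))"
    by (intro sum.cong refl sum.swap)
  also have "\<dots> = (\<Sum>c<d. \<Sum>a<d. \<Sum>b<d. cnj (P $$ (c, a) * v $ a) * (P $$ (c, b) * v $ b))"
    by (rule sum.swap)
  also have "\<dots> = (\<Sum>c<d. cnj (g c) * g c)"
    unfolding g_def cnj_sum sum_product ..
  also have "\<dots> = complex_of_real (\<Sum>c<d. (cmod (g c))\<^sup>2)"
    unfolding of_real_sum cmod_square_eq_cnj_mult ..
  finally show "0 \<le> (P *\<^sub>v v) \<bullet>c v"
    by (simp add: less_eq_complex_def sum_nonneg del: of_real_sum)
qed

lemma combination_square: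
  fixes U V :: "complex mat"
  assumes U: "U \<in> carrier_mat d d" and V: "V \<in> carrier_mat d d"
  shows "(a \<cdot>\<^sub>m U + b \<cdot>\<^sub>m V) * (a \<cdot>\<^sub>m U + b \<cdot>\<^sub>m V)
       = (a * a) \<cdot>\<^sub>m (U * U) + (b * b) \<cdot>\<^sub>m (V * V) + (a * b) \<cdot>\<^sub>m (U * V + V * U)"
proof (rule eq_matI)
  fix i j assume "i < dim_row ((a * a) \<cdot>\<^sub>m (U * U) + (b * b) \<cdot>\<^sub>m (V * V) + (a * b) \<cdot>\<^sub>m (U * V + V * U))"
    and "j < dim_col ((a * a) \<cdot>\<^sub>m (U * U) + (b * b) \<cdot>\<^sub>m (V * V) + (a * b) \<cdot>\<^sub>m (U * V + V * U))"
  then have "i < d" "j < d" using U V by auto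
  then show "((a \<cdot>\<^sub>m U + b \<cdot>\<^sub>m V) * (a \<cdot>\<^sub>m U + b \<cdot>\<^sub>m V)) $$ (i, j)
      = ((a * a) \<cdot>\<^sub>m (U * U) + (b * b) \<cdot>\<^sub>m (V * V) + (a * b) \<cdot>\<^sub>m (U * V + V * U)) $$ (i, j)"
    using U V by (simp add: scalar_prod_def sum_distrib_left sum.distrib algebra_simps)
qed (use U V in auto)

text \<open>
  Both products of a difference and a sum lose their mixed terms, so that only the squares
  \<open>P\<^sup>2\<close> and \<open>Q\<^sup>2\<close> matter.
\<close>

lemma orthogonal_pair_square:
  fixes P Q :: "complex mat"
  assumes P: "P \<in> carrier_mat d d" and Q: "Q \<in> carrier_mat d d"
    and "P * Q = 0\<^sub>m d d" "Q * P = 0\<^sub>m d d"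
  shows "(P - Q) * (P - Q) = (P + Q) * (P + Q)" "(P - Q) * (P + Q) = (P + Q) * (P - Q)"
proof -
  define A B where "A = P * P" and "B = Q * Q"
  have AB: "A \<in> carrier_mat d d" "B \<in> carrier_mat d d" using P Q by (auto simp: A_def B_def)
  have "P + Q \<in> carrier_mat d d" "P - Q \<in> carrier_mat d d" using P Q by auto
  note dist = add_mult_distrib_mat[OF P Q this(1)] add_mult_distrib_mat[OF P Q this(2)]
    minus_mult_distrib_mat[OF P Q this(1)] minus_mult_distrib_mat[OF P Q this(2)]
    mult_add_distrib_mat[OF P P Q] mult_add_distrib_mat[OF Q P Q]
    mult_minus_distrib_mat[OF P P Q] mult_minus_distrib_mat[OF Q P Q]
  show "(P - Q) * (P - Q) = (P + Q) * (P + Q)" "(P - Q) * (P + Q) = (P + Q) * (P - Q)"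
    unfolding dist assms(3,4) A_def[symmetric] B_def[symmetric] using AB
    by (intro eq_matI; simp)+
qed


section \<open>The reflections spanned by an anticommuting family\<close>

locale clifford_reflections = clifford_family e n \<gamma> "1\<^sub>m e" for e n \<gamma>
begin

text \<open>
  Any rational point of the unit circle with nonzero coordinates could serve as the pair of
  coefficients; \<open>(3/5, 4/5)\<close> avoids square roots.
\<close>

definition reflection :: "nat \<Rightarrow> nat \<Rightarrow> complex mat" where
  "reflection i j = (if i = j then \<gamma> i else (3 / 5) \<cdot>\<^sub>m \<gamma> i + (4 / 5) \<cdot>\<^sub>m \<gamma> j)"

text \<open>
  The triple \<open>(j, i, s)\<close> stands for the projection onto the eigenspace of \<open>reflection i j\<close> for the
  eigenvalue \<open>1\<close> or \<open>-1\<close>. The larger index comes first so that the range of \<open>i\<close> depends on \<open>j\<close>.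
\<close>

definition index_set :: "(nat \<times> nat \<times> bool) set" where
  "index_set = (SIGMA j:{..<n}. {..j} \<times> UNIV)"

fun projection :: "nat \<times> nat \<times> bool \<Rightarrow> complex mat" where
  "projection (j, i, s) = spectral_projection e (reflection i j) s"

lemma reflection_carrier: "i < n \<Longrightarrow> j < n \<Longrightarrow> reflection i j \<in> carrier_mat e e"
  using A_carrier by (simp add: reflection_def)

lemma reflection_adjoint: "i < n \<Longrightarrow> j < n \<Longrightarrow> mat_adjoint (reflection i j) = reflection i j"
  using A_carrier A_adjoint
  by (simp add: reflection_def mat_adjoint_add[of _ e] mat_adjoint_smult)

lemma reflection_square:
  assumes "i < n" "j < n"
  shows "reflection i j * reflection i j = 1\<^sub>m e"
proof (cases "i = j")
  case True
  then show ?thesis using A_square[OF assms(1)] by (simp add: reflection_def)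
next
  case False
  note c = A_carrier[OF assms(1)] A_carrier[OF assms(2)]
  have sq: "\<gamma> i * \<gamma> i = 1\<^sub>m e" "\<gamma> j * \<gamma> j = 1\<^sub>m e" using A_square assms by simp_all
  define U where "U = \<gamma> j * \<gamma> i"
  have U: "U \<in> carrier_mat e e" using c by (auto simp: U_def)
  show ?thesis
    using False U by (simp add: reflection_def combination_square[OF c] sq anticommute[OF assms False]
        flip: U_def) (auto intro!: eq_matI)
qed

lemma index_setI: "i \<le> j \<Longrightarrow> j < n \<Longrightarrow> (j, i, s) \<in> index_set"
  by (simp add: index_set_def)

lemma finite_index_set: "finite index_set"
  by (simp add: index_set_def)

lemma card_index_set: "card index_set = n * (n + 1)"
proof -
  have "card index_set = (\<Sum>j<n. 2 * Suc j)"
    by (simp add: index_set_def card_cartesian_product mult.commute)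
  also have "\<dots> = n * (n + 1)" by (induction n) auto
  finally show ?thesis .
qed

lemma projection_carrier: "t \<in> index_set \<Longrightarrow> projection t \<in> carrier_mat e e"
  by (auto simp: index_set_def reflection_carrier)

lemma projection_psd:
  assumes "t \<in> index_set"
  shows "hermitian_psd e (projection t)"
proof -
  obtain i j s where t: "t = (j, i, s)" and ij: "i < n" "j < n"
    using assms by (auto simp: index_set_def)
  note r = reflection_carrier[OF ij] reflection_adjoint[OF ij] reflection_square[OF ij]
  show ?thesis
    unfolding t projection.simps
    by (rule hermitian_idempotent_psd)
      (simp_all add: r spectral_projection_adjoint spectral_projection_mult)
qed

lemma projection_orthogonal:
  assumes "i \<le> j" "j < n"
  shows "trace_inner (projection (j, i, s)) (projection (j, i, \<not> s)) = 0"
proof -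
  have ij: "i < n" "j < n" using assms by auto
  note r = reflection_carrier[OF ij] reflection_adjoint[OF ij] reflection_square[OF ij]
  show ?thesis
    unfolding projection.simps trace_inner_hermitian[OF spectral_projection_adjoint[OF r(1,2)]]
      spectral_projection_mult[OF r(1,3)]
    by (simp add: mat_trace_def)
qed

lemma projection_index:
  assumes "i \<le> j" "j < n" "a < e" "b < e"
  shows "projection (j, i, s) $$ (a, b)
    = ((if a = b then 1 else 0) + (if s then 1 else - 1) * reflection i j $$ (a, b)) / 2"
  using assms reflection_carrier[of i j]
  by (simp add: spectral_projection_def)

text \<open>
  A factorization with the Gram matrix of the projections yields a \<open>clifford_family\<close>: \<open>K\<close> replaces
  the identity and the differences \<open>D i i\<close> replace the \<open>\<gamma> i\<close>.
\<close>

lemma factorization_dimension: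
  assumes n: "even n" "n > 0" and e: "e > 0"
    and psd: "\<And>t. t \<in> index_set \<Longrightarrow> hermitian_psd d (X t)"
    and gram: "\<And>s t. s \<in> index_set \<Longrightarrow> t \<in> index_set \<Longrightarrow>
      trace_inner (X s) (X t) = trace_inner (projection s) (projection t)"
  shows "2 ^ n \<le> d * d"
proof -
  have cX: "X t \<in> carrier_mat d d" "mat_adjoint (X t) = X t" if "t \<in> index_set" for t
    using psd[OF that] by (auto simp: hermitian_psd_def)
  note [simp] = index_setI
  have X: "X (j, i, s) \<in> carrier_mat d d" if "i \<le> j" "j < n" for j i s
    using cX that by simp
  note [simp] = carrier_matD[OF X]
  note transfer = gram_relation_transfer_list[where T = index_set and X = projection and Y = X
      and d = e and e = d, OF projection_carrier cX(1) gram[symmetric]]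
  define K where "K = X (0, 0, True) + X (0, 0, False)"
  define D where "D j i = X (j, i, True) - X (j, i, False)" for j i
  have cK: "K \<in> carrier_mat d d" using X n by (simp add: K_def)
  have cD: "D j i \<in> carrier_mat d d" if "i \<le> j" "j < n" for i j
    unfolding D_def by (rule minus_carrier_mat[OF X[OF that]])
  have aK: "mat_adjoint K = K"
    using X[of 0 0] cX(2) n by (simp add: K_def mat_adjoint_add[of _ d])
  have aD: "mat_adjoint (D j i) = D j i" if "i \<le> j" "j < n" for i j
    using X[OF that] cX(2) that by (simp add: D_def mat_adjoint_minus[of _ d])
  have K: "X (j, i, True) + X (j, i, False) = K" if ij: "i \<le> j" "j < n" for i j
  proof (rule eq_matI)
    fix a b assume "a < dim_row K" "b < dim_col K"
    then have ab: "a < d" "b < d" using cK by auto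
    have "(\<Sum>(c, t)\<leftarrow>[(1, (j, i, True)), (1, (j, i, False)), (- 1, (0, 0, True)), (- 1, (0, 0, False))].
        of_real c * X t $$ (a, b)) = 0"
      by (rule transfer) (use ij n ab in \<open>auto simp: projection_index field_simps simp del: projection.simps\<close>)
    then show "(X (j, i, True) + X (j, i, False)) $$ (a, b) = K $$ (a, b)"
      using ab ij X X[of 0 0] n by (simp add: K_def algebra_simps)
  qed (use X ij cK in auto)
  have comb: "D j i = (3 / 5) \<cdot>\<^sub>m D i i + (4 / 5) \<cdot>\<^sub>m D j j" if ij: "i < j" "j < n" for i j
  proof (rule eq_matI)
    fix a b assume "a < dim_row ((3 / 5) \<cdot>\<^sub>m D i i + (4 / 5) \<cdot>\<^sub>m D j j)"
      "b < dim_col ((3 / 5) \<cdot>\<^sub>m D i i + (4 / 5) \<cdot>\<^sub>m D j j)"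
    then have ab: "a < d" "b < d" using cD[of j j] ij by auto
    have zero: "(\<Sum>(c, t)\<leftarrow>[(1, (j, i, True)), (- 1, (j, i, False)), (- 3 / 5, (i, i, True)), (3 / 5, (i, i, False)),
        (- 4 / 5, (j, j, True)), (4 / 5, (j, j, False))]. of_real c * X t $$ (a, b)) = 0"
    proof (rule transfer)
      fix a b assume ab: "a < e" "b < e"
      have "reflection i j $$ (a, b)
          = 3 / 5 * reflection i i $$ (a, b) + 4 / 5 * reflection j j $$ (a, b)"
        using ab ij A_carrier[of i] A_carrier[of j] by (simp add: reflection_def)
      then show "(\<Sum>(c, t)\<leftarrow>[(1, (j, i, True)), (- 1, (j, i, False)), (- 3 / 5, (i, i, True)),
        (3 / 5, (i, i, False)), (- 4 / 5, (j, j, True)), (4 / 5, (j, j, False))].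
          of_real c * projection t $$ (a, b)) = 0"
        using ij ab by (simp add: projection_index add_divide_distrib diff_divide_distrib algebra_simps
            del: projection.simps)
    qed (use ij ab in auto)
    have "D j i $$ (a, b) - ((3 / 5) \<cdot>\<^sub>m D i i + (4 / 5) \<cdot>\<^sub>m D j j) $$ (a, b)
      = (\<Sum>(c, t)\<leftarrow>[(1, (j, i, True)), (- 1, (j, i, False)), (- 3 / 5, (i, i, True)), (3 / 5, (i, i, False)),
        (- 4 / 5, (j, j, True)), (4 / 5, (j, j, False))]. of_real c * X t $$ (a, b))"
      using ab ij by (simp add: D_def diff_divide_distrib algebra_simps)
    then show "D j i $$ (a, b) = ((3 / 5) \<cdot>\<^sub>m D i i + (4 / 5) \<cdot>\<^sub>m D j j) $$ (a, b)"
      unfolding zero by (simp only: right_minus_eq)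
  qed (use cD[of i j] cD[of j j] ij in auto)
  have square: "D j i * D j i = K * K" and D_K: "D j i * K = K * D j i" if ij: "i \<le> j" "j < n" for i j
  proof -
    have "X (j, i, s) * X (j, i, \<not> s) = 0\<^sub>m d d" for s
      by (rule psd_orthogonal_mult_eq_0)
        (use psd gram projection_orthogonal[OF ij] ij in \<open>simp_all del: projection.simps\<close>)
    from this[of True] this[of False]
    show "D j i * D j i = K * K" "D j i * K = K * D j i"
      unfolding K[OF ij, symmetric] D_def by (simp_all add: orthogonal_pair_square[OF X[OF ij] X[OF ij]])
  qed
  have anti: "D i i * D j j = - (D j j * D i i)" if ij: "i < j" "j < n" for i j
  proof -
    define S U V where "S = K * K" and "U = D i i * D j j" and "V = D j j * D i i"
    have c: "D i i \<in> carrier_mat d d" "D j j \<in> carrier_mat d d" using cD ij by auto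
    have cS: "S \<in> carrier_mat d d" "U \<in> carrier_mat d d" "V \<in> carrier_mat d d"
      using c cK by (auto simp: S_def U_def V_def)
    \<comment> \<open>The coefficients \<open>9/25\<close> and \<open>16/25\<close> of \<open>S\<close> add up to \<open>1\<close>, so that only the anticommutator is left.\<close>
    have eq: "S = (9 / 25) \<cdot>\<^sub>m S + (16 / 25) \<cdot>\<^sub>m S + (12 / 25) \<cdot>\<^sub>m (U + V)"
      using combination_square[OF c, of "3 / 5" "4 / 5"] square[of i j] square[of i i] square[of j j] ij
      by (simp add: comb[OF ij, symmetric] S_def U_def V_def)
    have "U $$ (a, b) = - V $$ (a, b)" if "a < d" "b < d" for a b
    proof -
      have "S $$ (a, b) = ((9 / 25) \<cdot>\<^sub>m S + (16 / 25) \<cdot>\<^sub>m S + (12 / 25) \<cdot>\<^sub>m (U + V)) $$ (a, b)"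
        by (simp only: eq[symmetric])
      also have "\<dots> = S $$ (a, b) + 12 / 25 * (U $$ (a, b) + V $$ (a, b))"
        using that cS by (simp add: field_simps)
      finally have "12 / 25 * (U $$ (a, b) + V $$ (a, b)) = 0" by (simp only: add_cancel_right_right)
      then show ?thesis by (subst (asm) mult_eq_0_iff) (simp add: eq_neg_iff_add_eq_0)
    qed
    then have "U = - V" using carrier_matD[OF cS(2)] carrier_matD[OF cS(3)] by (intro eq_matI) simp_all
    then show ?thesis by (simp add: U_def V_def)
  qed
  interpret X: clifford_family d n "\<lambda>i. D i i" K
  proof
    fix i j assume "i < n" "j < n" "i \<noteq> j"
    then consider "i < j" "j < n" | "j < i" "i < n" by linarith
    then show "D i i * D j j = - (D j j * D i i)"
    proof cases
      case 1
      then show ?thesis by (rule anti)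
    next
      case 2
      show ?thesis unfolding anti[OF 2] by simp
    qed
  qed (simp_all only: order_refl cD cK aD aK square D_K)
  \<comment> \<open>The relation \<open>K = 0\<close> would transfer back to the projections, whose pairs add up to the identity.\<close>
  have "K \<noteq> 0\<^sub>m d d"
  proof
    assume K0: "K = 0\<^sub>m d d"
    have "(\<Sum>(c, t)\<leftarrow>[(1, (0, 0, True)), (1, (0, 0, False))]. of_real c * projection t $$ (0, 0)) = 0"
    proof (rule gram_relation_transfer_list[where T = index_set and X = X and d = d and e = e])
      fix a b assume "a < d" "b < d"
      then show "(\<Sum>(c, t)\<leftarrow>[(1, (0, 0, True)), (1, (0, 0, False))]. of_real c * X t $$ (a, b)) = 0"
        using arg_cong[OF K0, of "\<lambda>M. M $$ (a, b)"] X[of 0 0] n by (simp add: K_def)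
    qed (use e n cX gram projection_carrier in auto)
    then show False using e n by (simp add: projection_index field_simps del: projection.simps)
  qed
  then show ?thesis by (rule X.dimension_bound[OF n(1)])
qed

end

section \<open>Completely positive semidefinite matrices of exponential rank\<close>

lemma hermitian_psd_zero: "hermitian_psd e (0\<^sub>m e e)"
  by (rule hermitian_idempotent_psd) (auto simp: mat_adjoint_zero)

theorem theorem1p1:
  fixes k :: nat
  assumes "k \<ge> 1"
  shows "\<exists>M :: real mat. completely_psd (4 * k^2 + 2 * k + 2) M \<and> cpsd_rank_complex M = 2 ^ k"
proof -
  define e :: nat where "e = 2 ^ k"
  define N where "N = 4 * k^2 + 2 * k + 2"
  have e: "e > 0" by (simp add: e_def)
  obtain \<gamma> where "clifford_family e (2 * k) \<gamma> (1\<^sub>m e)"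
    using clifford_family_exists[of k] by (auto simp: e_def)
  then interpret clifford_reflections e "2 * k" \<gamma> by (simp add: clifford_reflections_def)
  obtain g where g: "bij_betw g index_set {0..<card index_set}"
    using ex_bij_betw_finite_nat[OF finite_index_set] by blast
  have N: "N = card index_set + 2"
    unfolding N_def card_index_set by (simp add: power2_eq_square algebra_simps)
  \<comment> \<open>The two indices beyond the projections receive the zero matrix.\<close>
  define F where "F q = (if q < card index_set then projection (inv_into index_set g q) else 0\<^sub>m e e)" for q
  have F_g: "F (g t) = projection t" and g_less: "g t < N" if "t \<in> index_set" for t
    using bij_betw_apply[OF g that] bij_betw_inv_into_left[OF g that] by (simp_all add: F_def N)
  have psd: "hermitian_psd e (F q)" for q
    using bij_betw_apply[OF bij_betw_inv_into[OF g], of q]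
    by (simp add: F_def projection_psd hermitian_psd_zero)
  then have F: "F q \<in> carrier_mat e e" "mat_adjoint (F q) = F q" for q
    by (auto simp: hermitian_psd_def)
  define M where "M = mat N N (\<lambda>(p, q). Re (trace_inner (F p) (F q)))"
  have M: "complex_of_real (M $$ (p, q)) = trace_inner (F p) (F q)" if "p < N" "q < N" for p q
    using that trace_inner_hermitian_real(1)[OF F(1) F(1) F(2) F(2)] by (simp add: M_def)
  have fact: "cpsd_factorization N M e F"
    using psd M by (simp add: cpsd_factorization_def)
  have "completely_psd N M"
    unfolding completely_psd_def
  proof (intro conjI)
    show "transpose_mat M = M"
      using trace_inner_hermitian_real(2)[OF F(1) F(1) F(2) F(2)] by (intro eq_matI) (auto simp: M_def)
    show "\<exists>d\<ge>1. \<exists>X. cpsd_factorization N M d X"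
      using fact e by (intro exI[of _ e]) auto
  qed (simp add: M_def)
  moreover have "cpsd_rank_complex M = 2 ^ k"
    unfolding cpsd_rank_complex_def
  proof (rule Least_equality)
    show "1 \<le> (2::nat) ^ k \<and> (\<exists>X. cpsd_factorization (dim_row M) M (2 ^ k) X)"
      using fact by (auto simp: M_def e_def)
  next
    fix d assume "1 \<le> d \<and> (\<exists>X. cpsd_factorization (dim_row M) M d X)"
    then obtain X where X: "cpsd_factorization N M d X" by (auto simp: M_def)
    have "2 ^ (2 * k) \<le> d * d"
    proof (rule factorization_dimension[where X = "\<lambda>t. X (g t)"])
      fix s t assume "s \<in> index_set" "t \<in> index_set"
      then show "trace_inner (X (g s)) (X (g t)) = trace_inner (projection s) (projection t)"
        using X M[of "g s" "g t"] by (simp add: cpsd_factorization_def g_less F_g)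
    qed (use assms e X g_less in \<open>auto simp: cpsd_factorization_def\<close>)
    then have "(2 ^ k)\<^sup>2 \<le> d\<^sup>2"
      by (simp add: power_mult power2_eq_square mult.commute[of 2 k])
    then show "2 ^ k \<le> d" using power2_nat_le_eq_le by blast
  qed
  ultimately show ?thesis unfolding N_def by blast
qed

end
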